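(* Let $u\in\mathbb R^n$. (i) Suppose that the restricted inf-compactness holds at $\bar x$ in direction $u$ with compact set $\Omega_u$ and the feasible map $\mathcal F$ satisfies RS at each $(\bar x,y)\in\mathrm{gph}\,S$. Then $V$ is directionally Lipschitz continuous at $\bar x$ in direction $u$. (ii) Suppose there exists $\bar y\in S(\bar x)$ such that $S(x)$ is inner semi-continuous at $(\bar x,\bar y)$ in direction $u$, and the feasible map $\mathcal F$ satisfies RS at $(\bar x,\bar y)$ in direction $u$. Then $V$ is directionally Lipschitz continuous at $\bar x$ in direction $u$. Furthermore, if the hypotheses of (i) or of (ii) hold in direction $u=0$, then $V$ is Lipschitz continuous at (i.e. around) $\bar x$.
   Context: Let $f:\mathbb R^n\times\mathbb R^m\to\mathbb R$ and $g:\mathbb R^n\times\mathbb R^m\to\mathbb R^p$ be continuously differentiable. Consider $(P_x)$: $\min_y f(x,y)$ s.t. $g(x,y)\le0$. Feasible map $\mathcal F(x)=\{y:g(x,y)\le0\}$; value function $V(x)=\inf\{f(x,y):y\in\mathcal F(x)\}$; $S(x)$ = set of optimal solutions of $(P_x)$; $\mathrm{gph}$ denotes the graph. $\mathbb B$ is the open unit ball, $\mathbb B_\epsilon(\bar y)$ the open ball of radius $\epsilon$ about $\bar y$. For a direction $d$ and $\epsilon,\delta>0$: $\mathcal V_{\epsilon,\delta}(d):=\{z\in\epsilon\mathbb B : \big\|\,\|d\|z-\|z\|d\,\big\|\le\delta\|z\|\|d\|\}$ (equal to $\epsilon\mathbb B$ when $d=0$). $V$ is directionally Lipschitz continuous at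 $\bar x$ in direction $u$ if there are $L,\epsilon,\delta>0$ such that $V$ is finite on $\bar x+\mathcal V_{\epsilon,\delta}(u)$ and $|V(x)-V(x')|\le L\|x-x'\|$ for all $x,x'\in\bar x+\mathcal V_{\epsilon,\delta}(u)$. Robinson stability (RS) of $\mathcal F$ at $(\bar x,\bar y)\in\mathrm{gph}\,\mathcal F$ in direction $u$: there are $\kappa,\epsilon,\delta>0$ with $\mathrm{dist}(y,\mathcal F(x))\le\kappa\|g_+(x,y)\|$ for all $x\in\bar x+\mathcal V_{\epsilon,\delta}(u)$, $y\in\mathbb B_\epsilon(\bar y)$, where $g_+=\max\{0,g\}$ componentwise. "RS at $(\bar x,\bar y)$" without a direction means RS in direction $0$. Restricted inf-compactness at $\bar x$ in direction $u$ with compact set $\Omega_u\subseteq\mathbb R^m$: $V(\bar x)$ is finite and there are $\epsilon,\delta>0$ such that for all $x\in\bar x+\mathcal V_{\epsilon,\delta}(u)$ with $V(x)<V(\bar x)+\epsilon$ one has $S(x)\cap\Omega_u\ne\emptyset$. Directional inner semi-continuity: for $\bar y\in S(\bar x)$, $S$ is inner semi-continuous at $(\bar x,\bar y)$ in direction $u$ if for any sequences $t_k\downarrow0$, $u^k\to u$, there exists a sequence $y^k\in S(\bar x+t_ku^k)$ converging to $\bar y$. *)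

theory Defs
  imports "HOL-Analysis.Analysis"
begin

definition continuously_differentiable ::
  "('a::real_normed_vector \<Rightarrow> 'b::real_normed_vector) \<Rightarrow> bool" where
  "continuously_differentiable h \<longleftrightarrow>
     (\<exists>h'. (\<forall>z. (h has_derivative blinfun_apply (h' z)) (at z)) \<and> continuous_on UNIV h')"

definition feasible ::
  "((real^'n) \<times> (real^'m) \<Rightarrow> real^'p) \<Rightarrow> real^'n \<Rightarrow> (real^'m) set" where
  "feasible g x = {y. \<forall>i. g (x, y) $ i \<le> 0}"

text \<open>The value function is extended-real-valued; it is \<open>\<infinity>\<close> where the feasible set is empty.\<close>

definition value_fun ::
  "((real^'n) \<times> (real^'m) \<Rightarrow> real) \<Rightarrow> ((real^'n) \<times> (real^'m) \<Rightarrow> real^'p) \<Rightarrow> real^'n \<Rightarrow> ereal" where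
  "value_fun f g x = (INF y\<in>feasible g x. ereal (f (x, y)))"

definition solutions ::
  "((real^'n) \<times> (real^'m) \<Rightarrow> real) \<Rightarrow> ((real^'n) \<times> (real^'m) \<Rightarrow> real^'p) \<Rightarrow> real^'n \<Rightarrow> (real^'m) set" where
  "solutions f g x = {y \<in> feasible g x. \<forall>y'\<in>feasible g x. f (x, y) \<le> f (x, y')}"

definition graph_of :: "('a \<Rightarrow> 'b set) \<Rightarrow> ('a \<times> 'b) set" where
  "graph_of F = {(x, y). y \<in> F x}"

definition dir_nbhd :: "real \<Rightarrow> real \<Rightarrow> 'a::real_normed_vector \<Rightarrow> 'a set" where
  "dir_nbhd \<epsilon> \<delta> d =
     {z \<in> ball 0 \<epsilon>. norm (norm d *\<^sub>R z - norm z *\<^sub>R d) \<le> \<delta> * norm z * norm d}"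

definition dir_lipschitz_at :: "('a::real_normed_vector \<Rightarrow> ereal) \<Rightarrow> 'a \<Rightarrow> 'a \<Rightarrow> bool" where
  "dir_lipschitz_at V xbar u \<longleftrightarrow>
     (\<exists>L>0. \<exists>\<epsilon>>0. \<exists>\<delta>>0.
        (\<forall>x \<in> (+) xbar ` dir_nbhd \<epsilon> \<delta> u. \<bar>V x\<bar> \<noteq> \<infinity>) \<and>
        (\<forall>x \<in> (+) xbar ` dir_nbhd \<epsilon> \<delta> u. \<forall>x' \<in> (+) xbar ` dir_nbhd \<epsilon> \<delta> u.
           \<bar>real_of_ereal (V x) - real_of_ereal (V x')\<bar> \<le> L * norm (x - x')))"

definition lipschitz_around :: "('a::real_normed_vector \<Rightarrow> ereal) \<Rightarrow> 'a \<Rightarrow> bool" where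
  "lipschitz_around V xbar \<longleftrightarrow>
     (\<exists>L. \<exists>\<epsilon>>0. (\<forall>x \<in> ball xbar \<epsilon>. \<bar>V x\<bar> \<noteq> \<infinity>) \<and>
        L-lipschitz_on (ball xbar \<epsilon>) (\<lambda>x. real_of_ereal (V x)))"

text \<open>Distance to a set with the convention that the distance to the empty set is \<open>\<infinity>\<close>
  (whereas \<open>infdist y {} = 0\<close>), so that Robinson stability forces nearby feasible sets
  to be nonempty.\<close>

definition set_dist :: "'a::metric_space \<Rightarrow> 'a set \<Rightarrow> ereal" where
  "set_dist y A = (INF a\<in>A. ereal (dist y a))"

definition pos_part :: "real^'p \<Rightarrow> real^'p" where
  "pos_part v = (\<chi> i. max 0 (v $ i))"

definition robinson_stable ::
  "((real^'n) \<times> (real^'m) \<Rightarrow> real^'p) \<Rightarrow> real^'n \<Rightarrow> real^'m \<Rightarrow> real^'n \<Rightarrow> bool" where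
  "robinson_stable g xbar ybar u \<longleftrightarrow>
     (xbar, ybar) \<in> graph_of (feasible g) \<and>
     (\<exists>\<kappa>>0. \<exists>\<epsilon>>0. \<exists>\<delta>>0. \<forall>x \<in> (+) xbar ` dir_nbhd \<epsilon> \<delta> u. \<forall>y \<in> ball ybar \<epsilon>.
        set_dist y (feasible g x) \<le> ereal (\<kappa> * norm (pos_part (g (x, y)))))"

definition restricted_inf_compact ::
  "((real^'n) \<times> (real^'m) \<Rightarrow> real) \<Rightarrow> ((real^'n) \<times> (real^'m) \<Rightarrow> real^'p) \<Rightarrow>
   real^'n \<Rightarrow> real^'n \<Rightarrow> (real^'m) set \<Rightarrow> bool" where
  "restricted_inf_compact f g xbar u \<Omega> \<longleftrightarrow>
     compact \<Omega> \<and> \<bar>value_fun f g xbar\<bar> \<noteq> \<infinity> \<and>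
     (\<exists>\<epsilon>>0. \<exists>\<delta>>0. \<forall>x \<in> (+) xbar ` dir_nbhd \<epsilon> \<delta> u.
        value_fun f g x < value_fun f g xbar + ereal \<epsilon> \<longrightarrow> solutions f g x \<inter> \<Omega> \<noteq> {})"

text \<open>As usual for inner limits of set-valued maps, the selection \<open>y k\<close> is required to lie in the
  image sets for all large \<open>k\<close>. Requiring it for every \<open>k\<close> would force \<open>S\<close> to be nonempty-valued
  on the whole space, since the first terms of \<open>t\<close> and \<open>w\<close> are arbitrary.\<close>

definition dir_inner_semicontinuous ::
  "('a::real_normed_vector \<Rightarrow> 'b::metric_space set) \<Rightarrow> 'a \<Rightarrow> 'b \<Rightarrow> 'a \<Rightarrow> bool" where
  "dir_inner_semicontinuous S xbar ybar u \<longleftrightarrow>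
     ybar \<in> S xbar \<and>
     (\<forall>(t :: nat \<Rightarrow> real) w. (\<forall>k. t k > 0) \<longrightarrow> t \<longlonglongrightarrow> 0 \<longrightarrow> w \<longlonglongrightarrow> u \<longrightarrow>
        (\<exists>y. (\<forall>\<^sub>F k in sequentially. y k \<in> S (xbar + t k *\<^sub>R w k)) \<and> y \<longlonglongrightarrow> ybar))"

end

theory Submission
  imports Defs
begin

text \<open>Robinson stability at a point \<open>y\<close> of \<open>S(x)\<close> yields a feasible point for a neighbouring parameter
  \<open>x'\<close> within distance \<open>\<kappa> \<parallel>g\<^sub>+(x', y)\<parallel>\<close> of \<open>y\<close>. As \<open>g\<^sub>+(x, y) = 0\<close> and \<open>g\<close> is locally Lipschitz, this
  distance is of order \<open>\<parallel>x' - x\<parallel>\<close>, so \<open>V(x') \<le> V(x) + L \<parallel>x' - x\<parallel>\<close>. Exchanging \<open>x\<close> and \<open>x'\<close> gives the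
  Lipschitz estimate, provided the stability constants are uniform over the solutions \<open>y\<close> that occur.
  Under inner semicontinuity these solutions are close to a single \<open>y\<close>; under restricted
  inf-compactness a sequential compactness argument on \<open>\<Omega>\<close> makes the constants uniform.\<close>

section \<open>Directional neighbourhoods and their sequences\<close>

lemma dir_nbhd_zero_direction [simp]: "dir_nbhd \<epsilon> \<delta> 0 = ball 0 \<epsilon>"
  by (auto simp: dir_nbhd_def)

lemma zero_in_dir_nbhd [simp]: "\<epsilon> > 0 \<Longrightarrow> 0 \<in> dir_nbhd \<epsilon> \<delta> d"
  by (simp add: dir_nbhd_def)

lemma dir_nbhd_subset_ball: "dir_nbhd \<epsilon> \<delta> d \<subseteq> ball 0 \<epsilon>"
  by (auto simp: dir_nbhd_def)

lemma dir_nbhd_mono: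
  assumes "\<epsilon> \<le> \<epsilon>'" "\<delta> \<le> \<delta>'"
  shows "dir_nbhd \<epsilon> \<delta> d \<subseteq> dir_nbhd \<epsilon>' \<delta>' d"
proof
  fix z assume z: "z \<in> dir_nbhd \<epsilon> \<delta> d"
  have "\<delta> * norm z * norm d \<le> \<delta>' * norm z * norm d"
    using assms by (intro mult_right_mono) auto
  with z assms show "z \<in> dir_nbhd \<epsilon>' \<delta>' d"
    by (auto simp: dir_nbhd_def)
qed

lemma translated_ball_zero: "(+) x ` ball 0 \<epsilon> = ball (x::'a::real_normed_vector) \<epsilon>"
  using ball_translation[of x 0 \<epsilon>] by simp

text \<open>This links the neighbourhood form of directional statements to the sequential form
  \<open>xbar + t k *\<^sub>R w k\<close> in which inner semicontinuity is phrased. A cone of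
  shrinking aperture \<open>\<rho> k\<close> leaves \<open>u\<close> as the only possible limit
  direction.\<close>

lemma dir_nbhd_parametrization:
  fixes z :: "nat \<Rightarrow> 'a::real_normed_vector"
  assumes z: "\<And>k. z k \<in> dir_nbhd (\<rho> k) (\<rho> k) u" and nz: "\<And>k. z k \<noteq> 0" and \<rho>: "\<rho> \<longlonglongrightarrow> 0"
  obtains t w where "\<And>k. t k > (0::real)" "t \<longlonglongrightarrow> 0" "w \<longlonglongrightarrow> u" "\<And>k. t k *\<^sub>R w k = z k"
proof (cases "u = 0")
  case True
  have "(\<lambda>k. norm (z k)) \<longlonglongrightarrow> 0"
    by (rule tendsto_sandwich[OF _ _ tendsto_const \<rho>])
       (use z True in \<open>auto intro!: always_eventually simp: less_imp_le\<close>)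
  then have s0: "(\<lambda>k. sqrt (norm (z k))) \<longlonglongrightarrow> 0"
    using tendsto_real_sqrt[of _ 0] by simp
  \<comment> \<open>For \<open>u = 0\<close> both factors must tend to 0. Dividing
    \<open>z k\<close> by its norm would leave unit vectors, whereas the square root splits the norm
    evenly between \<open>t k\<close> and \<open>w k\<close>.\<close>
  define w where "w k = z k /\<^sub>R sqrt (norm (z k))" for k
  have "norm (w k) = sqrt (norm (z k))" for k
    by (simp add: w_def real_div_sqrt flip: divide_inverse_commute)
  then have "(\<lambda>k. norm (w k)) \<longlonglongrightarrow> 0"
    using s0 by presburger
  then have "w \<longlonglongrightarrow> 0"
    by (rule tendsto_norm_zero_cancel)
  with s0 show ?thesis
    using True nz by (intro that[of "\<lambda>k. sqrt (norm (z k))" w]) (auto simp: w_def)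
next
  case False
  \<comment> \<open>This scale gives \<open>w k\<close> the norm of \<open>u\<close>, so that the
    inequality defining \<open>dir_nbhd\<close>, divided by \<open>norm (z k)\<close>, bounds
    \<open>norm (w k - u)\<close> directly.\<close>
  define t where "t k = norm (z k) / norm u" for k
  define w where "w k = z k /\<^sub>R t k" for k
  have tpos: "t k > 0" for k
    using False nz by (simp add: t_def)
  have "(\<lambda>k. norm (z k)) \<longlonglongrightarrow> 0"
    by (rule tendsto_sandwich[OF _ _ tendsto_const \<rho>])
       (use z in \<open>auto intro!: always_eventually simp: less_imp_le dir_nbhd_def\<close>)
  then have t0: "t \<longlonglongrightarrow> 0"
    unfolding t_def by (auto intro: tendsto_divide_zero)
  have bound: "norm (w k - u) \<le> \<rho> k * norm u" for k
  proof -
    have "norm u *\<^sub>R z k - norm (z k) *\<^sub>R u = norm (z k) *\<^sub>R (w k - u)"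
      using False nz[of k] by (simp add: w_def t_def scaleR_diff_right)
    then have "norm (z k) * norm (w k - u) = norm (norm u *\<^sub>R z k - norm (z k) *\<^sub>R u)"
      by simp
    also have "\<dots> \<le> norm (z k) * (\<rho> k * norm u)"
      using z[of k] by (simp add: dir_nbhd_def mult_ac)
    finally show ?thesis
      using nz[of k] by simp
  qed
  have "(\<lambda>k. norm (w k - u)) \<longlonglongrightarrow> 0"
  proof (rule tendsto_sandwich[OF _ _ tendsto_const])
    show "(\<lambda>k. \<rho> k * norm u) \<longlonglongrightarrow> 0"
      using \<rho> by (rule tendsto_mult_left_zero)
  qed (use bound in auto)
  then have "w \<longlonglongrightarrow> u"
    by (rule LIM_zero_cancel[OF tendsto_norm_zero_cancel])
  moreover have "t k *\<^sub>R w k = z k" for k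
    using tpos[of k] by (simp add: w_def)
  ultimately show ?thesis
    using tpos t0 that by blast
qed

lemma dir_lipschitz_at_zero_imp_lipschitz_around:
  assumes "dir_lipschitz_at V x 0"
  shows "lipschitz_around V x"
proof -
  obtain L \<epsilon> where "L > 0" "\<epsilon> > 0" and fin: "\<forall>y\<in>ball x \<epsilon>. \<bar>V y\<bar> \<noteq> \<infinity>"
    and lip: "\<forall>y\<in>ball x \<epsilon>. \<forall>z\<in>ball x \<epsilon>.
        \<bar>real_of_ereal (V y) - real_of_ereal (V z)\<bar> \<le> L * norm (y - z)"
    using assms unfolding dir_lipschitz_at_def dir_nbhd_zero_direction translated_ball_zero by blast
  have "L-lipschitz_on (ball x \<epsilon>) (\<lambda>x. real_of_ereal (V x))"
    using lip \<open>L > 0\<close> by (intro lipschitz_onI) (auto simp: dist_real_def dist_norm)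
  with fin \<open>\<epsilon> > 0\<close> show ?thesis
    unfolding lipschitz_around_def by blast
qed

section \<open>Continuity and Lipschitz bounds from continuous differentiability\<close>

lemma continuously_differentiable_imp_continuous_on:
  assumes "continuously_differentiable h"
  shows "continuous_on S h"
  using assms unfolding continuously_differentiable_def
  by (meson continuous_at_imp_continuous_on has_derivative_continuous)

text \<open>Enlarging \<open>S\<close> to a closed ball supplies both ingredients of the mean value
  inequality: convexity, and compactness, on which the continuous derivative is bounded.\<close>

lemma continuously_differentiable_imp_lipschitz_on_bounded:
  fixes h :: "'a::euclidean_space \<Rightarrow> 'b::real_normed_vector"
  assumes "continuously_differentiable h" "bounded S"
  obtains L where "L-lipschitz_on S h"
proof -
  obtain h' where h': "\<And>z. (h has_derivative blinfun_apply (h' z)) (at z)"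
    and cont: "continuous_on UNIV h'"
    using assms(1) unfolding continuously_differentiable_def by blast
  obtain R where R: "S \<subseteq> cball 0 R"
    using bounded_subset_ballD[OF assms(2)] ball_subset_cball by blast
  have "bounded (h' ` cball 0 R)"
    by (intro compact_imp_bounded compact_continuous_image continuous_on_subset[OF cont]) auto
  then obtain C where "C > 0" and C: "\<And>z. z \<in> cball 0 R \<Longrightarrow> norm (h' z) \<le> C"
    unfolding bounded_pos by blast
  have "C-lipschitz_on (cball 0 R) h"
  proof (rule bounded_derivative_imp_lipschitz)
    show "(h has_derivative blinfun_apply (h' z)) (at z within cball 0 R)" for z
      using h' has_derivative_at_withinI by blast
    show "onorm (blinfun_apply (h' z)) \<le> C" if "z \<in> cball 0 R" for z
      using C[OF that] by (simp add: norm_blinfun.rep_eq)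
  qed (use \<open>C > 0\<close> in auto)
  then show ?thesis
    using that lipschitz_on_subset R by blast
qed

section \<open>One-sided and two-sided estimates of the value function\<close>

lemma value_fun_eq_of_solution:
  assumes "y \<in> solutions f g x"
  shows "value_fun f g x = ereal (f (x, y))"
  unfolding value_fun_def
proof (rule antisym)
  show "(INF y\<in>feasible g x. ereal (f (x, y))) \<le> ereal (f (x, y))"
    using assms by (intro INF_lower) (auto simp: solutions_def)
  show "ereal (f (x, y)) \<le> (INF y\<in>feasible g x. ereal (f (x, y)))"
    using assms by (intro INF_greatest) (auto simp: solutions_def)
qed

text \<open>Where \<open>a $ i\<close> is positive, it is at most \<open>a $ i - b $ i\<close>. With
  \<open>b\<close> the constraint value at a feasible point, the residual at a shifted parameter is
  thus controlled by the variation of \<open>g\<close>.\<close>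

lemma norm_pos_part_le_diff:
  assumes "\<forall>i. b $ i \<le> 0"
  shows "norm (pos_part a) \<le> norm (a - b)"
proof (rule norm_le_componentwise_cart)
  show "norm (pos_part a $ i) \<le> norm ((a - b) $ i)" for i
    using assms[rule_format, of i] by (auto simp: pos_part_def max_def)
qed

lemma dist_Pair_le: "dist (a, b) (c, d) \<le> dist a c + dist b d"
  unfolding dist_Pair_Pair by (rule sqrt_sum_squares_le_sum) auto

text \<open>The constant \<open>L\<close> is fixed before \<open>x\<close>, \<open>x'\<close> and
  \<open>y\<close>: it is built from \<open>D\<close>, \<open>B\<close>, \<open>\<kappa>\<close> and
  Lipschitz constants of \<open>f\<close> and \<open>g\<close> on bounded sets. Hence one constant
  serves all pairs of parameters.\<close>

lemma value_fun_upper_estimate: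
  fixes f :: "(real^'n) \<times> (real^'m) \<Rightarrow> real" and g :: "(real^'n) \<times> (real^'m) \<Rightarrow> real^'p"
  assumes f: "continuously_differentiable f" and g: "continuously_differentiable g"
    and "bounded D" "bounded B" "\<kappa> > 0"
  obtains L where "L > 0"
    "\<And>x x' y. \<lbrakk>x \<in> D; x' \<in> D; y \<in> B; y \<in> solutions f g x;
        set_dist y (feasible g x') \<le> ereal (\<kappa> * norm (pos_part (g (x', y))))\<rbrakk>
      \<Longrightarrow> value_fun f g x' \<le> value_fun f g x + ereal (L * norm (x - x'))"
proof -
  obtain Lg where Lg: "Lg-lipschitz_on (D \<times> B) g"
    using continuously_differentiable_imp_lipschitz_on_bounded[OF g bounded_Times[OF assms(3,4)]]
    by metis
  have Lg0: "Lg \<ge> 0"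
    using Lg lipschitz_on_nonneg by blast
  obtain Rd where Rd: "\<And>x. x \<in> D \<Longrightarrow> norm x \<le> Rd"
    using assms(3) unfolding bounded_iff by blast
  obtain Rb where Rb: "\<And>y. y \<in> B \<Longrightarrow> norm y \<le> Rb"
    using assms(4) unfolding bounded_iff by blast
  \<comment> \<open>The residual bound for \<open>g\<close> gives distance at most
    \<open>\<kappa> * Lg * dist x x'\<close>. The added 1 makes the bound strict when
    \<open>x \<noteq> x'\<close>, so that an actual feasible point \<open>y'\<close> lies below it
    although the distance is only an infimum.\<close>
  define M where "M = \<kappa> * Lg + 1"
  have M: "M > 0"
    using Lg0 \<open>\<kappa> > 0\<close> by (simp add: M_def add_nonneg_pos)
  \<comment> \<open>The point \<open>y'\<close> may leave \<open>B\<close>, but it stays within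
    \<open>M * dist x x'\<close> of \<open>y\<close>, and \<open>dist x x'\<close> is at most
    \<open>2 * Rd\<close>. This ball therefore contains both \<open>y\<close> and
    \<open>y'\<close>.\<close>
  define B' where "B' = cball (0::real^'m) (Rb + M * (2 * Rd))"
  obtain Lf where Lf: "Lf-lipschitz_on (D \<times> B') f"
    using continuously_differentiable_imp_lipschitz_on_bounded[OF f
        bounded_Times[OF assms(3) bounded_cball]] unfolding B'_def by metis
  have Lf0: "Lf \<ge> 0"
    using Lf lipschitz_on_nonneg by blast
  \<comment> \<open>The pairs \<open>(x, y)\<close> and \<open>(x', y')\<close> are at most
    \<open>(1 + M) * dist x x'\<close> apart; the added 1 keeps \<open>L\<close> positive even if
    \<open>Lf\<close> is 0.\<close>
  define L where "L = Lf * (1 + M) + 1"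
  have "L > 0"
    using Lf0 M by (simp add: L_def add_nonneg_pos)
  moreover have "value_fun f g x' \<le> value_fun f g x + ereal (L * norm (x - x'))"
    if x: "x \<in> D" and x': "x' \<in> D" and y: "y \<in> B" and sol: "y \<in> solutions f g x"
      and stable: "set_dist y (feasible g x') \<le> ereal (\<kappa> * norm (pos_part (g (x', y))))"
    for x x' y
  proof (cases "x = x'")
    case True
    then show ?thesis
      by (simp add: zero_ereal_def[symmetric])
  next
    case False
    have "\<forall>i. g (x, y) $ i \<le> 0"
      using sol by (auto simp: solutions_def feasible_def)
    then have "norm (pos_part (g (x', y))) \<le> dist (g (x', y)) (g (x, y))"
      unfolding dist_norm by (rule norm_pos_part_le_diff)
    also have "\<dots> \<le> Lg * dist (x', y) (x, y)"
      using Lg x x' y by (auto intro: lipschitz_onD)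
    also have "\<dots> \<le> Lg * dist x x'"
      using dist_Pair_le[of x' y x y] Lg0 by (auto simp: dist_commute intro: mult_left_mono)
    finally have "\<kappa> * norm (pos_part (g (x', y))) \<le> \<kappa> * (Lg * dist x x')"
      using \<open>\<kappa> > 0\<close> by simp
    also have "\<dots> < M * dist x x'"
      using False by (simp add: M_def algebra_simps)
    finally have "set_dist y (feasible g x') < ereal (M * dist x x')"
      using stable by (meson le_less_trans less_ereal.simps(1))
    then obtain y' where y': "y' \<in> feasible g x'" "dist y y' < M * dist x x'"
      unfolding set_dist_def by (auto simp: INF_less_iff)
    have "dist x x' \<le> 2 * Rd"
      using Rd[OF x] Rd[OF x'] norm_triangle_ineq4[of x x'] by (simp add: dist_norm)
    then have M2: "M * dist x x' \<le> M * (2 * Rd)"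
      using M by simp
    then have yB': "y \<in> B'"
      using Rb[OF y] M zero_le_dist[of x x'] unfolding B'_def
      by (smt (verit) mem_cball_0 mult_nonneg_nonneg)
    have y'B': "y' \<in> B'"
      using Rb[OF y] y'(2) M2 norm_triangle_sub[of y' y] unfolding B'_def
      by (simp add: dist_norm norm_minus_commute)
    have "f (x', y') \<le> f (x, y) + dist (f (x', y')) (f (x, y))"
      by (simp add: dist_real_def)
    also have "dist (f (x', y')) (f (x, y)) \<le> Lf * dist (x', y') (x, y)"
      using Lf x x' yB' y'B' by (auto intro: lipschitz_onD)
    also have "\<dots> \<le> Lf * (dist x x' + M * dist x x')"
      using dist_Pair_le[of x' y' x y] y'(2) Lf0
      by (intro mult_left_mono) (auto simp: dist_commute)
    also have "\<dots> \<le> L * norm (x - x')"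
      by (simp add: L_def dist_norm algebra_simps)
    finally have fle: "f (x', y') \<le> f (x, y) + L * norm (x - x')"
      by simp
    have "value_fun f g x' \<le> ereal (f (x', y'))"
      unfolding value_fun_def using y'(1) by (rule INF_lower)
    also have "\<dots> \<le> ereal (f (x, y) + L * norm (x - x'))"
      using fle by simp
    also have "\<dots> = value_fun f g x + ereal (L * norm (x - x'))"
      by (simp add: value_fun_eq_of_solution[OF sol])
    finally show ?thesis .
  qed
  ultimately show ?thesis
    using that by blast
qed

text \<open>Common last step of both cases. The hypothesis is required for every ordered pair of
  parameters, so the one-sided estimate can be used with \<open>x\<close> and \<open>x'\<close>
  exchanged.\<close>

lemma dir_lipschitz_at_value_fun_if_uniformly_stable:
  fixes f :: "(real^'n) \<times> (real^'m) \<Rightarrow> real" and g :: "(real^'n) \<times> (real^'m) \<Rightarrow> real^'p"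
  assumes f: "continuously_differentiable f" and g: "continuously_differentiable g"
    and "bounded B" "\<kappa> > 0" "\<epsilon> > 0" "\<delta> > 0"
    and stable: "\<And>x x'. \<lbrakk>x \<in> (+) xbar ` dir_nbhd \<epsilon> \<delta> u; x' \<in> (+) xbar ` dir_nbhd \<epsilon> \<delta> u\<rbrakk>
      \<Longrightarrow> \<exists>y \<in> solutions f g x \<inter> B.
          set_dist y (feasible g x') \<le> ereal (\<kappa> * norm (pos_part (g (x', y))))"
  shows "dir_lipschitz_at (value_fun f g) xbar u"
proof -
  define D where "D = (+) xbar ` dir_nbhd \<epsilon> \<delta> u"
  have "D \<subseteq> ball xbar \<epsilon>"
    unfolding D_def using dir_nbhd_subset_ball translated_ball_zero by blast
  then have "bounded D"
    using bounded_ball bounded_subset by blast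
  then obtain L where "L > 0" and L: "\<And>x x' y. \<lbrakk>x \<in> D; x' \<in> D; y \<in> B; y \<in> solutions f g x;
        set_dist y (feasible g x') \<le> ereal (\<kappa> * norm (pos_part (g (x', y))))\<rbrakk>
      \<Longrightarrow> value_fun f g x' \<le> value_fun f g x + ereal (L * norm (x - x'))"
    using value_fun_upper_estimate[OF f g _ \<open>bounded B\<close> \<open>\<kappa> > 0\<close>] by blast
  \<comment> \<open>Taking both parameters equal to \<open>x\<close> yields a solution at
    \<open>x\<close>, where the value function is then attained and finite.\<close>
  have fin: "\<bar>value_fun f g x\<bar> \<noteq> \<infinity>" if "x \<in> D" for x
    using stable[folded D_def, OF that that] by (auto simp: value_fun_eq_of_solution)
  have one_sided: "real_of_ereal (value_fun f g x') \<le>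
      real_of_ereal (value_fun f g x) + L * norm (x - x')" if "x \<in> D" "x' \<in> D" for x x'
  proof -
    have "value_fun f g x' \<le> value_fun f g x + ereal (L * norm (x - x'))"
      using stable[folded D_def, OF that] L[OF that] by auto
    with fin[OF that(1)] fin[OF that(2)] show ?thesis
      by (cases "value_fun f g x"; cases "value_fun f g x'") auto
  qed
  have "\<bar>real_of_ereal (value_fun f g x) - real_of_ereal (value_fun f g x')\<bar> \<le> L * norm (x - x')"
    if "x \<in> D" "x' \<in> D" for x x'
    using one_sided[OF that] one_sided[OF that(2,1)] by (simp add: norm_minus_commute abs_le_iff)
  with fin have "(\<forall>x\<in>D. \<bar>value_fun f g x\<bar> \<noteq> \<infinity>) \<and> (\<forall>x\<in>D. \<forall>x'\<in>D.
      \<bar>real_of_ereal (value_fun f g x) - real_of_ereal (value_fun f g x')\<bar> \<le> L * norm (x - x'))"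
    by simp
  with \<open>L > 0\<close> \<open>\<epsilon> > 0\<close> \<open>\<delta> > 0\<close> show ?thesis
    unfolding dir_lipschitz_at_def D_def by blast
qed

section \<open>The case of inner semicontinuous solutions\<close>

text \<open>Turns the sequential definition into a neighbourhood statement: if all radii
  \<open>inverse (Suc k)\<close> failed, the failing points would form a sequence approaching
  \<open>xbar\<close> in direction \<open>u\<close> whose solution sets avoid a fixed ball around
  \<open>ybar\<close>.\<close>

lemma dir_inner_semicontinuous_nbhd:
  assumes isc: "dir_inner_semicontinuous S xbar ybar u" and "\<rho> > 0"
  obtains \<epsilon> where "\<epsilon> > 0" "\<And>x. x \<in> (+) xbar ` dir_nbhd \<epsilon> \<epsilon> u \<Longrightarrow> S x \<inter> ball ybar \<rho> \<noteq> {}"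
proof (rule ccontr)
  assume contra: "\<not> thesis"
  have "\<exists>z\<in>dir_nbhd (inverse (Suc k)) (inverse (Suc k)) u. S (xbar + z) \<inter> ball ybar \<rho> = {}"
    for k :: nat
  proof (rule ccontr)
    assume "\<not> ?thesis"
    then have thesis
      by (intro that[of "inverse (Suc k)"]) auto
    with contra show False ..
  qed
  then obtain z where z: "\<And>k. z k \<in> dir_nbhd (inverse (Suc k)) (inverse (Suc k)) u"
    and empty: "\<And>k::nat. S (xbar + z k) \<inter> ball ybar \<rho> = {}"
    by metis
  have ybar: "ybar \<in> S xbar"
    using isc unfolding dir_inner_semicontinuous_def by blast
  \<comment> \<open>At \<open>z k = 0\<close> the point \<open>ybar\<close> itself would lie in the
    intersection assumed empty.\<close>
  have nz: "z k \<noteq> 0" for k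
    using empty[of k] ybar \<open>\<rho> > 0\<close> by force
  obtain t w where "\<And>k. t k > 0" "t \<longlonglongrightarrow> 0" "w \<longlonglongrightarrow> u" and tw: "\<And>k. t k *\<^sub>R w k = z k"
    using dir_nbhd_parametrization[OF z nz LIMSEQ_inverse_real_of_nat] by metis
  then have "\<exists>y. (\<forall>\<^sub>F k in sequentially. y k \<in> S (xbar + t k *\<^sub>R w k)) \<and> y \<longlonglongrightarrow> ybar"
    using isc unfolding dir_inner_semicontinuous_def by blast
  then obtain y where y: "\<forall>\<^sub>F k in sequentially. y k \<in> S (xbar + z k)" "y \<longlonglongrightarrow> ybar"
    unfolding tw by blast
  have "\<forall>\<^sub>F k in sequentially. y k \<in> ball ybar \<rho>"
    using tendstoD[OF y(2) \<open>\<rho> > 0\<close>] by (simp add: dist_commute)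
  with y(1) have "\<forall>\<^sub>F k in sequentially. False"
    by eventually_elim (use empty in blast)
  then show False by simp
qed

text \<open>Each nearby directional parameter has a solution in the ball around \<open>ybar\<close>
  on which stability holds, so the constants of this single point are already uniform.\<close>

lemma dir_lipschitz_at_value_fun_inner_semicontinuous:
  fixes f :: "(real^'n) \<times> (real^'m) \<Rightarrow> real" and g :: "(real^'n) \<times> (real^'m) \<Rightarrow> real^'p"
  assumes f: "continuously_differentiable f" and g: "continuously_differentiable g"
    and isc: "dir_inner_semicontinuous (solutions f g) xbar ybar u"
    and rs: "robinson_stable g xbar ybar u"
  shows "dir_lipschitz_at (value_fun f g) xbar u"
proof -
  obtain \<kappa> \<epsilon> \<delta> where "\<kappa> > 0" "\<epsilon> > 0" "\<delta> > 0"
    and stable: "\<And>x y. \<lbrakk>x \<in> (+) xbar ` dir_nbhd \<epsilon> \<delta> u; y \<in> ball ybar \<epsilon>\<rbrakk>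
      \<Longrightarrow> set_dist y (feasible g x) \<le> ereal (\<kappa> * norm (pos_part (g (x, y))))"
    using rs unfolding robinson_stable_def by blast
  obtain \<eta> where "\<eta> > 0"
    and \<eta>: "\<And>x. x \<in> (+) xbar ` dir_nbhd \<eta> \<eta> u \<Longrightarrow> solutions f g x \<inter> ball ybar \<epsilon> \<noteq> {}"
    using dir_inner_semicontinuous_nbhd[OF isc \<open>\<epsilon> > 0\<close>] by blast
  show ?thesis
  proof (rule dir_lipschitz_at_value_fun_if_uniformly_stable
      [OF f g bounded_ball[of ybar \<epsilon>] \<open>\<kappa> > 0\<close>, of "min \<epsilon> \<eta>" "min \<delta> \<eta>"])
    fix x x'
    assume "x \<in> (+) xbar ` dir_nbhd (min \<epsilon> \<eta>) (min \<delta> \<eta>) u"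
      and "x' \<in> (+) xbar ` dir_nbhd (min \<epsilon> \<eta>) (min \<delta> \<eta>) u"
    moreover have "dir_nbhd (min \<epsilon> \<eta>) (min \<delta> \<eta>) u \<subseteq> dir_nbhd \<eta> \<eta> u"
      and "dir_nbhd (min \<epsilon> \<eta>) (min \<delta> \<eta>) u \<subseteq> dir_nbhd \<epsilon> \<delta> u"
      by (intro dir_nbhd_mono; simp)+
    ultimately have "x \<in> (+) xbar ` dir_nbhd \<eta> \<eta> u" "x' \<in> (+) xbar ` dir_nbhd \<epsilon> \<delta> u"
      by (meson image_mono subsetD)+
    then show "\<exists>y\<in>solutions f g x \<inter> ball ybar \<epsilon>.
        set_dist y (feasible g x') \<le> ereal (\<kappa> * norm (pos_part (g (x', y))))"
      using \<eta>[of x] stable[of x'] by blast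
  qed (use \<open>\<epsilon> > 0\<close> \<open>\<delta> > 0\<close> \<open>\<eta> > 0\<close> in auto)
qed

section \<open>The case of restricted inf-compactness\<close>

lemma robinson_stable_zero_directionE:
  assumes "robinson_stable g xbar ybar 0"
  obtains \<kappa> \<epsilon> where "\<kappa> > 0" "\<epsilon> > 0"
    "\<And>x y. \<lbrakk>x \<in> ball xbar \<epsilon>; y \<in> ball ybar \<epsilon>\<rbrakk>
      \<Longrightarrow> set_dist y (feasible g x) \<le> ereal (\<kappa> * norm (pos_part (g (x, y))))"
proof -
  obtain \<kappa> \<epsilon> \<delta> where "\<kappa> > 0" "\<epsilon> > 0"
    and "\<forall>x \<in> (+) xbar ` dir_nbhd \<epsilon> \<delta> 0. \<forall>y \<in> ball ybar \<epsilon>.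
      set_dist y (feasible g x) \<le> ereal (\<kappa> * norm (pos_part (g (x, y))))"
    using assms unfolding robinson_stable_def by blast
  then show ?thesis
    unfolding dir_nbhd_zero_direction translated_ball_zero using that by blast
qed

text \<open>Only the fixed solution \<open>y\<close> at \<open>xbar\<close> is moved, so nothing is
  assumed about solutions at neighbouring parameters. The estimate can thus be used before such
  solutions are known to exist.\<close>

lemma value_fun_calm_from_above:
  fixes f :: "(real^'n) \<times> (real^'m) \<Rightarrow> real" and g :: "(real^'n) \<times> (real^'m) \<Rightarrow> real^'p"
  assumes f: "continuously_differentiable f" and g: "continuously_differentiable g"
    and sol: "y \<in> solutions f g xbar" and rs: "robinson_stable g xbar y 0"
  obtains L \<epsilon> where "L > 0" "\<epsilon> > 0"
    "\<And>x. x \<in> ball xbar \<epsilon> \<Longrightarrow> value_fun f g x \<le> value_fun f g xbar + ereal (L * norm (xbar - x))"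
proof -
  obtain \<kappa> \<epsilon> where "\<kappa> > 0" "\<epsilon> > 0"
    and stable: "\<And>x y'. \<lbrakk>x \<in> ball xbar \<epsilon>; y' \<in> ball y \<epsilon>\<rbrakk>
      \<Longrightarrow> set_dist y' (feasible g x) \<le> ereal (\<kappa> * norm (pos_part (g (x, y'))))"
    using robinson_stable_zero_directionE[OF rs] by blast
  obtain L where "L > 0" and L: "\<And>x x' y'. \<lbrakk>x \<in> ball xbar \<epsilon>; x' \<in> ball xbar \<epsilon>; y' \<in> {y};
        y' \<in> solutions f g x;
        set_dist y' (feasible g x') \<le> ereal (\<kappa> * norm (pos_part (g (x', y'))))\<rbrakk>
      \<Longrightarrow> value_fun f g x' \<le> value_fun f g x + ereal (L * norm (x - x'))"
    using value_fun_upper_estimate[OF f g bounded_ball finite_imp_bounded \<open>\<kappa> > 0\<close>, of "{y}" xbar \<epsilon>]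
    by blast
  show ?thesis
    using L[of xbar _ y] stable[of _ y] sol \<open>\<epsilon> > 0\<close> by (intro that[OF \<open>L > 0\<close> \<open>\<epsilon> > 0\<close>]) auto
qed

text \<open>Feasibility passes to the limit by continuity of \<open>g\<close>. Optimality needs the
  upper bound on the values: it gives \<open>f (x k, y k) \<le> f (xbar, y0) + c k\<close>, hence in
  the limit \<open>ybar\<close> does no worse than the optimal \<open>y0\<close>.\<close>

lemma solutions_limit:
  fixes f :: "(real^'n) \<times> (real^'m) \<Rightarrow> real" and g :: "(real^'n) \<times> (real^'m) \<Rightarrow> real^'p"
  assumes f: "continuous_on UNIV f" and g: "continuous_on UNIV g"
    and sol: "y0 \<in> solutions f g xbar"
    and usc: "\<forall>\<^sub>F k in sequentially. value_fun f g (x k) \<le> value_fun f g xbar + ereal (c k)"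
    and "c \<longlonglongrightarrow> 0" and x: "x \<longlonglongrightarrow> xbar" and y: "y \<longlonglongrightarrow> ybar"
    and mem: "\<And>k. y k \<in> solutions f g (x k)"
  shows "ybar \<in> solutions f g xbar"
proof -
  have xy: "(\<lambda>k. (x k, y k)) \<longlonglongrightarrow> (xbar, ybar)"
    using x y by (rule tendsto_Pair)
  have flim: "(\<lambda>k. f (x k, y k)) \<longlonglongrightarrow> f (xbar, ybar)"
    using continuous_on_tendsto_compose[OF f xy] by simp
  have glim: "(\<lambda>k. g (x k, y k)) \<longlonglongrightarrow> g (xbar, ybar)"
    using continuous_on_tendsto_compose[OF g xy] by simp
  have "g (xbar, ybar) $ i \<le> 0" for i
  proof (rule tendsto_upperbound[OF tendsto_vec_nth[OF glim]])
    show "\<forall>\<^sub>F k in sequentially. g (x k, y k) $ i \<le> 0"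
      using mem by (auto simp: solutions_def feasible_def)
  qed simp
  then have feas: "ybar \<in> feasible g xbar"
    by (simp add: feasible_def)
  have "f (xbar, ybar) \<le> f (xbar, y0) + 0"
  proof (rule tendsto_le[OF _ tendsto_add[OF tendsto_const \<open>c \<longlonglongrightarrow> 0\<close>] flim])
    show "\<forall>\<^sub>F k in sequentially. f (x k, y k) \<le> f (xbar, y0) + c k"
      using usc by eventually_elim
        (simp add: value_fun_eq_of_solution[OF sol] value_fun_eq_of_solution[OF mem])
  qed simp
  then show ?thesis
    using feas sol by (auto simp: solutions_def intro: order_trans)
qed

text \<open>Stability constants vary with the solution. If no common pair existed, failures with
  constant \<open>Suc k\<close> and radius \<open>inverse (Suc k)\<close> would accumulate, by
  compactness of \<open>\<Omega>\<close>, at a solution \<open>ybar\<close> of the base problem,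
  contradicting the stability there.\<close>

lemma uniform_robinson_constant:
  fixes f :: "(real^'n) \<times> (real^'m) \<Rightarrow> real" and g :: "(real^'n) \<times> (real^'m) \<Rightarrow> real^'p"
  assumes f: "continuously_differentiable f" and g: "continuously_differentiable g"
    and "compact \<Omega>" and y0: "y0 \<in> solutions f g xbar"
    and rs: "\<And>y. y \<in> solutions f g xbar \<Longrightarrow> robinson_stable g xbar y 0"
  obtains \<kappa> \<epsilon> where "\<kappa> > 0" "\<epsilon> > 0"
    "\<And>x x' y. \<lbrakk>x \<in> ball xbar \<epsilon>; x' \<in> ball xbar \<epsilon>; y \<in> solutions f g x \<inter> \<Omega>\<rbrakk>
      \<Longrightarrow> set_dist y (feasible g x') \<le> ereal (\<kappa> * norm (pos_part (g (x', y))))"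
proof (rule ccontr)
  assume contra: "\<not> thesis"
  have "\<exists>x x' y. x \<in> ball xbar (inverse (Suc k)) \<and> x' \<in> ball xbar (inverse (Suc k)) \<and>
      y \<in> solutions f g x \<inter> \<Omega> \<and>
      \<not> set_dist y (feasible g x') \<le> ereal (Suc k * norm (pos_part (g (x', y))))" for k :: nat
  proof (rule ccontr)
    assume "\<not> ?thesis"
    with that[of "Suc k" "inverse (Suc k)"] have thesis
      by auto
    with contra show False ..
  qed
  then obtain x x' y where x: "\<And>k::nat. x k \<in> ball xbar (inverse (Suc k))"
    and x': "\<And>k::nat. x' k \<in> ball xbar (inverse (Suc k))"
    and y: "\<And>k::nat. y k \<in> solutions f g (x k) \<inter> \<Omega>"
    and unstable: "\<And>k::nat. \<not> set_dist (y k) (feasible g (x' k))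
      \<le> ereal (Suc k * norm (pos_part (g (x' k, y k))))"
    by metis
  have "a \<longlonglongrightarrow> xbar" if a: "\<And>k::nat. a k \<in> ball xbar (inverse (Suc k))" for a
  proof -
    have "(\<lambda>k. dist (a k) xbar) \<longlonglongrightarrow> 0"
      by (rule tendsto_sandwich[OF _ _ tendsto_const LIMSEQ_inverse_real_of_nat])
         (use a in \<open>auto intro!: always_eventually simp: dist_commute less_imp_le\<close>)
    then show ?thesis
      using tendsto_dist_iff by blast
  qed
  with x x' have xlim: "x \<longlonglongrightarrow> xbar" and x'lim: "x' \<longlonglongrightarrow> xbar"
    by blast+
  obtain ybar r where "ybar \<in> \<Omega>" and r: "strict_mono r" and ylim: "(y \<circ> r) \<longlonglongrightarrow> ybar"
    using \<open>compact \<Omega>\<close> y unfolding compact_def by (metis IntD2)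
  have xr: "(x \<circ> r) \<longlonglongrightarrow> xbar" and x'r: "(x' \<circ> r) \<longlonglongrightarrow> xbar"
    using LIMSEQ_subseq_LIMSEQ r xlim x'lim by blast+
  \<comment> \<open>Calmness at \<open>y0\<close> supplies the upper semicontinuity that makes the
    cluster point \<open>ybar\<close> optimal and not merely feasible.\<close>
  obtain L \<eta> where "L > 0" "\<eta> > 0" and usc: "\<And>x. x \<in> ball xbar \<eta>
      \<Longrightarrow> value_fun f g x \<le> value_fun f g xbar + ereal (L * norm (xbar - x))"
    using value_fun_calm_from_above[OF f g y0 rs[OF y0]] by blast
  have ybar: "ybar \<in> solutions f g xbar"
  proof (rule solutions_limit[OF _ _ y0 _ _ xr ylim])
    show "\<forall>\<^sub>F k in sequentially. value_fun f g ((x \<circ> r) k)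
        \<le> value_fun f g xbar + ereal (L * norm (xbar - (x \<circ> r) k))"
      using tendstoD[OF xr \<open>\<eta> > 0\<close>] by eventually_elim (use usc in \<open>auto simp: dist_commute\<close>)
    have "(\<lambda>k. L * norm (xbar - (x \<circ> r) k)) \<longlonglongrightarrow> L * norm (xbar - xbar)"
      by (intro tendsto_intros xr)
    then show "(\<lambda>k. L * norm (xbar - (x \<circ> r) k)) \<longlonglongrightarrow> 0"
      by simp
    show "(y \<circ> r) k \<in> solutions f g ((x \<circ> r) k)" for k
      using y by simp
  qed (use f g continuously_differentiable_imp_continuous_on in blast)+
  obtain \<kappa> \<epsilon> where "\<kappa> > 0" "\<epsilon> > 0"
    and stable: "\<And>x y. \<lbrakk>x \<in> ball xbar \<epsilon>; y \<in> ball ybar \<epsilon>\<rbrakk>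
      \<Longrightarrow> set_dist y (feasible g x) \<le> ereal (\<kappa> * norm (pos_part (g (x, y))))"
    using robinson_stable_zero_directionE[OF rs[OF ybar]] by blast
  obtain N :: nat where N: "\<kappa> \<le> real N"
    using real_arch_simple by blast
  have "\<forall>\<^sub>F k in sequentially. False"
    using tendstoD[OF x'r \<open>\<epsilon> > 0\<close>] tendstoD[OF ylim \<open>\<epsilon> > 0\<close>] eventually_ge_at_top[of N]
  proof eventually_elim
    case (elim k)
    let ?p = "norm (pos_part (g (x' (r k), y (r k))))"
    \<comment> \<open>A strictly increasing \<open>r\<close> satisfies \<open>k \<le> r k\<close>,
      so from \<open>N\<close> on the failing constant \<open>Suc (r k)\<close> exceeds the valid
      constant \<open>\<kappa>\<close>.\<close>
    have "real N \<le> real (Suc (r k))"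
      using elim(3) seq_suble[OF r, of k] by linarith
    with N have "\<kappa> * ?p \<le> Suc (r k) * ?p"
      by (intro mult_right_mono) auto
    moreover have "set_dist (y (r k)) (feasible g (x' (r k))) \<le> ereal (\<kappa> * ?p)"
      using elim by (intro stable) (auto simp: dist_commute)
    ultimately show False
      using unstable[of "r k"] by (meson ereal_less_eq(3) order_trans)
  qed
  then show False by simp
qed

text \<open>Inf-compactness gives solutions in \<open>\<Omega>\<close> only where the value is below
  its level at \<open>xbar\<close> plus \<open>\<alpha>\<close>. Calmness from above guarantees this
  near \<open>xbar\<close>, and compactness of \<open>\<Omega>\<close> then makes the stability
  uniform.\<close>

lemma dir_lipschitz_at_value_fun_inf_compact:
  fixes f :: "(real^'n) \<times> (real^'m) \<Rightarrow> real" and g :: "(real^'n) \<times> (real^'m) \<Rightarrow> real^'p"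
  assumes f: "continuously_differentiable f" and g: "continuously_differentiable g"
    and ric: "restricted_inf_compact f g xbar u \<Omega>"
    and rs: "\<And>y. y \<in> solutions f g xbar \<Longrightarrow> robinson_stable g xbar y 0"
  shows "dir_lipschitz_at (value_fun f g) xbar u"
proof -
  have "compact \<Omega>" and fin: "\<bar>value_fun f g xbar\<bar> \<noteq> \<infinity>"
    using ric unfolding restricted_inf_compact_def by auto
  obtain \<alpha> \<delta> where "\<alpha> > 0" "\<delta> > 0"
    and \<Omega>: "\<And>x. \<lbrakk>x \<in> (+) xbar ` dir_nbhd \<alpha> \<delta> u; value_fun f g x < value_fun f g xbar + ereal \<alpha>\<rbrakk>
      \<Longrightarrow> solutions f g x \<inter> \<Omega> \<noteq> {}"
    using ric unfolding restricted_inf_compact_def by metis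
  \<comment> \<open>Inf-compactness is first applied at \<open>xbar\<close> itself; finiteness of
    the value there makes the level condition strict and yields the starting solution
    \<open>y0\<close>.\<close>
  have "xbar \<in> (+) xbar ` dir_nbhd \<alpha> \<delta> u"
    using \<open>\<alpha> > 0\<close> zero_in_dir_nbhd by (metis add.right_neutral imageI)
  moreover have "value_fun f g xbar < value_fun f g xbar + ereal \<alpha>"
    using fin \<open>\<alpha> > 0\<close> by (cases "value_fun f g xbar") auto
  ultimately obtain y0 where y0: "y0 \<in> solutions f g xbar"
    using \<Omega> by blast
  obtain L \<eta> where "L > 0" "\<eta> > 0" and usc: "\<And>x. x \<in> ball xbar \<eta>
      \<Longrightarrow> value_fun f g x \<le> value_fun f g xbar + ereal (L * norm (xbar - x))"
    using value_fun_calm_from_above[OF f g y0 rs[OF y0]] by blast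
  obtain \<kappa> \<epsilon> where "\<kappa> > 0" "\<epsilon> > 0"
    and stable: "\<And>x x' y. \<lbrakk>x \<in> ball xbar \<epsilon>; x' \<in> ball xbar \<epsilon>; y \<in> solutions f g x \<inter> \<Omega>\<rbrakk>
      \<Longrightarrow> set_dist y (feasible g x') \<le> ereal (\<kappa> * norm (pos_part (g (x', y))))"
    using uniform_robinson_constant[OF f g \<open>compact \<Omega>\<close> y0 rs] by blast
  \<comment> \<open>The four bounds serve inf-compactness, calmness, the condition
    \<open>L * norm (xbar - x) < \<alpha>\<close>, and uniform stability, in this order.\<close>
  define \<rho> where "\<rho> = Min {\<alpha>, \<eta>, \<alpha> / L, \<epsilon>}"
  have \<rho>: "\<rho> > 0" "\<rho> \<le> \<alpha>" "\<rho> \<le> \<eta>" "\<rho> \<le> \<alpha> / L" "\<rho> \<le> \<epsilon>"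
    using \<open>\<alpha> > 0\<close> \<open>\<eta> > 0\<close> \<open>L > 0\<close> \<open>\<epsilon> > 0\<close> by (auto simp: \<rho>_def)
  have near: "(+) xbar ` dir_nbhd \<rho> \<delta> u \<subseteq> ball xbar \<rho>"
    using dir_nbhd_subset_ball translated_ball_zero by blast
  have nonempty: "solutions f g x \<inter> \<Omega> \<noteq> {}" if x: "x \<in> (+) xbar ` dir_nbhd \<rho> \<delta> u" for x
  proof (rule \<Omega>)
    show "x \<in> (+) xbar ` dir_nbhd \<alpha> \<delta> u"
      using x dir_nbhd_mono[OF \<rho>(2) order_refl] by blast
    have xb: "x \<in> ball xbar \<rho>"
      using x near by blast
    then have "norm (xbar - x) < \<alpha> / L"
      using \<rho>(4) by (auto simp: dist_norm)
    then have "L * norm (xbar - x) < \<alpha>"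
      using \<open>L > 0\<close> by (simp add: field_simps)
    then have "value_fun f g xbar + ereal (L * norm (xbar - x)) < value_fun f g xbar + ereal \<alpha>"
      using fin by (cases "value_fun f g xbar") auto
    with usc[of x] xb \<rho>(3) show "value_fun f g x < value_fun f g xbar + ereal \<alpha>"
      by auto
  qed
  show ?thesis
  proof (rule dir_lipschitz_at_value_fun_if_uniformly_stable
      [OF f g compact_imp_bounded[OF \<open>compact \<Omega>\<close>] \<open>\<kappa> > 0\<close> \<rho>(1) \<open>\<delta> > 0\<close>])
    fix x x'
    assume x: "x \<in> (+) xbar ` dir_nbhd \<rho> \<delta> u" and x': "x' \<in> (+) xbar ` dir_nbhd \<rho> \<delta> u"
    then have "x \<in> ball xbar \<epsilon>" "x' \<in> ball xbar \<epsilon>"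
      using near \<rho>(5) by auto
    then show "\<exists>y\<in>solutions f g x \<inter> \<Omega>.
        set_dist y (feasible g x') \<le> ereal (\<kappa> * norm (pos_part (g (x', y))))"
      using nonempty[OF x] stable by blast
  qed
qed

theorem theorem4p1:
  fixes f :: "(real^'n) \<times> (real^'m) \<Rightarrow> real"
    and g :: "(real^'n) \<times> (real^'m) \<Rightarrow> real^'p"
    and xbar u :: "real^'n"
  assumes "continuously_differentiable f"
    and "continuously_differentiable g"
  shows
    "((\<exists>\<Omega>. restricted_inf_compact f g xbar u \<Omega>) \<and>
      (\<forall>y. (xbar, y) \<in> graph_of (solutions f g) \<longrightarrow> robinson_stable g xbar y 0)
      \<longrightarrow> dir_lipschitz_at (value_fun f g) xbar u)
   \<and> ((\<exists>ybar \<in> solutions f g xbar.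
        dir_inner_semicontinuous (solutions f g) xbar ybar u \<and> robinson_stable g xbar ybar u)
      \<longrightarrow> dir_lipschitz_at (value_fun f g) xbar u)
   \<and> ((\<exists>\<Omega>. restricted_inf_compact f g xbar 0 \<Omega>) \<and>
      (\<forall>y. (xbar, y) \<in> graph_of (solutions f g) \<longrightarrow> robinson_stable g xbar y 0)
      \<longrightarrow> lipschitz_around (value_fun f g) xbar)
   \<and> ((\<exists>ybar \<in> solutions f g xbar.
        dir_inner_semicontinuous (solutions f g) xbar ybar 0 \<and> robinson_stable g xbar ybar 0)
      \<longrightarrow> lipschitz_around (value_fun f g) xbar)"
proof -
  \<comment> \<open>The direction \<open>d\<close> is kept arbitrary so that the same fact covers
    both \<open>u\<close> and 0.\<close>
  have inf_compact: "dir_lipschitz_at (value_fun f g) xbar d"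
    if hyp: "(\<exists>\<Omega>. restricted_inf_compact f g xbar d \<Omega>) \<and>
      (\<forall>y. (xbar, y) \<in> graph_of (solutions f g) \<longrightarrow> robinson_stable g xbar y 0)" for d
  proof -
    obtain \<Omega> where "restricted_inf_compact f g xbar d \<Omega>"
      using hyp by blast
    then show ?thesis
      by (rule dir_lipschitz_at_value_fun_inf_compact[OF assms]) (use hyp in \<open>simp add: graph_of_def\<close>)
  qed
  have inner_semicontinuous: "dir_lipschitz_at (value_fun f g) xbar d"
    if "\<exists>ybar \<in> solutions f g xbar.
        dir_inner_semicontinuous (solutions f g) xbar ybar d \<and> robinson_stable g xbar ybar d" for d
    using that dir_lipschitz_at_value_fun_inner_semicontinuous[OF assms] by auto
  show ?thesis
    by (intro conjI impI dir_lipschitz_at_zero_imp_lipschitz_around;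
        erule inf_compact inner_semicontinuous)
qed

end
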